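(* Let $\xi\in(0,1)$ and $\varepsilon>0$ be constants and $t=n^{\xi}$. No quantum algorithm exists that computes the number $z$ of LZ77 factors of a text $X[1\,.\,.\,n]$ using only $o(\sqrt{zn})$ queries for all texts with $z \in [t^{1-\varepsilon}\,.\,.\,t]$.
   Context: $z$ is the number of phrases of the LZ77 factorization of $X$: greedy left-to-right parsing where each phrase is the longest fragment starting at the current position that also occurs starting at an earlier position (overlaps allowed), or a single character when none exists. Texts are over an integer alphabet of size polynomial in $n$. Quantum oracle access to $X$ is via $|i,b\rangle\mapsto|i,b\oplus X[i]\rangle$; algorithms are bounded-error and queries are calls to this oracle. *)

theory Defs
  imports Complex_Main "HOL-Library.Landau_Symbols"
begin

text \<open>
  Texts are lists of natural numbers; the position \<open>i \<in> {1..n}\<close> of a text \<open>X[1..n]\<close> is the list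
  index \<open>i - 1\<close>.
\<close>

definition previous_occurrence :: "'a list \<Rightarrow> nat \<Rightarrow> nat \<Rightarrow> bool" where
  "previous_occurrence X i l \<longleftrightarrow>
     i + l \<le> length X \<and> (\<exists>j<i. take l (drop j X) = take l (drop i X))"

definition phrase_length :: "'a list \<Rightarrow> nat \<Rightarrow> nat" where
  "phrase_length X i =
     (if \<exists>l\<ge>1. previous_occurrence X i l then (GREATEST l. previous_occurrence X i l) else 1)"

lemma phrase_length_pos: "phrase_length X i > 0"
proof (cases "\<exists>l\<ge>1. previous_occurrence X i l")
  case True
  then obtain l where l: "l \<ge> 1" "previous_occurrence X i l" by blast
  have "l \<le> (GREATEST l. previous_occurrence X i l)"
    by (rule Greatest_le_nat[of _ _ "length X"]) (use l in \<open>auto simp: previous_occurrence_def\<close>)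
  with l True show ?thesis by (simp add: phrase_length_def)
qed (auto simp: phrase_length_def)

function lz77_from :: "'a list \<Rightarrow> nat \<Rightarrow> 'a list list" where
  "lz77_from X i =
     (if i < length X
      then take (phrase_length X i) (drop i X) # lz77_from X (i + phrase_length X i)
      else [])"
  by pat_completeness auto
termination
  by (relation "measure (\<lambda>(X, i). length X - i)") (auto simp: phrase_length_pos diff_less_mono2)

declare lz77_from.simps [simp del]

definition lz77 :: "'a list \<Rightarrow> 'a list list" where
  "lz77 X = lz77_from X 0"

definition lz77_size :: "'a list \<Rightarrow> nat" where
  "lz77_size X = length (lz77 X)"

text \<open>
  A basis state \<open>(i, b, w)\<close> consists of a query position, a query answer register of
  \<open>answer_bits\<close> qubits and a workspace of dimension \<open>work_dim\<close>.  A state is the function giving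
  its amplitudes.

  Since the number \<open>z\<close> that bounds the queries depends on the unknown text, the number of queries
  is not fixed in advance: after the unitary \<open>step t\<close>, which follows the \<open>t\<close>-th query, the
  algorithm measures \<open>outcome\<close>; the result \<open>Some v\<close> means that it halts with output \<open>v\<close>, and
  \<open>None\<close> that it continues with another query.
\<close>

type_synonym basis_state = "nat \<times> nat \<times> nat"
type_synonym state = "basis_state \<Rightarrow> complex"

record query_algorithm =
  answer_bits :: nat
  work_dim :: nat
  step :: "nat \<Rightarrow> basis_state \<Rightarrow> basis_state \<Rightarrow> complex"
  outcome :: "basis_state \<Rightarrow> nat option"

definition basis :: "query_algorithm \<Rightarrow> nat \<Rightarrow> basis_state set" where
  "basis A n = {..<n} \<times> {..<2 ^ answer_bits A} \<times> {..<work_dim A}"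

definition unitary_on :: "'b set \<Rightarrow> ('b \<Rightarrow> 'b \<Rightarrow> complex) \<Rightarrow> bool" where
  "unitary_on B U \<longleftrightarrow>
     (\<forall>r\<in>B. \<forall>s\<in>B. (\<Sum>q\<in>B. cnj (U q r) * U q s) = (if r = s then 1 else 0))"

definition valid_algorithm :: "query_algorithm \<Rightarrow> nat \<Rightarrow> nat \<Rightarrow> bool" where
  "valid_algorithm A n \<sigma> \<longleftrightarrow>
     \<sigma> \<le> 2 ^ answer_bits A \<and> 0 < work_dim A \<and> (\<forall>t. unitary_on (basis A n) (step A t))"

definition apply_op :: "'b set \<Rightarrow> ('b \<Rightarrow> 'b \<Rightarrow> complex) \<Rightarrow> ('b \<Rightarrow> complex) \<Rightarrow> 'b \<Rightarrow> complex" where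
  "apply_op B U \<psi> = (\<lambda>r. \<Sum>s\<in>B. U r s * \<psi> s)"

definition ket :: "'b \<Rightarrow> 'b \<Rightarrow> complex" where
  "ket s = (\<lambda>r. if r = s then 1 else 0)"

text \<open>
  The linear map sending the basis state \<open>(i, b, w)\<close> to \<open>(i, b XOR X!i, w)\<close>: as this permutation
  of the basis is an involution, it acts on amplitudes by the same substitution.
\<close>

definition oracle_call :: "nat list \<Rightarrow> state \<Rightarrow> state" where
  "oracle_call X \<psi> = (\<lambda>(i, b, w). \<psi> (i, Bit_Operations.xor b (X ! i), w))"

definition continue_part :: "query_algorithm \<Rightarrow> state \<Rightarrow> state" where
  "continue_part A \<psi> = (\<lambda>s. if outcome A s = None then \<psi> s else 0)"

text \<open>
  The states of a run are not renormalised after the measurements, so that squared norms are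
  the probabilities of not having halted earlier.
\<close>

primrec run :: "query_algorithm \<Rightarrow> nat list \<Rightarrow> nat \<Rightarrow> state" where
  "run A X 0 = apply_op (basis A (length X)) (step A 0) (ket (0, 0, 0))"
| "run A X (Suc t) =
     apply_op (basis A (length X)) (step A (Suc t)) (oracle_call X (continue_part A (run A X t)))"

text \<open>The probability that \<open>A\<close> on \<open>X\<close> halts with output \<open>v\<close> after at most \<open>T\<close> queries.\<close>

definition output_prob :: "query_algorithm \<Rightarrow> nat list \<Rightarrow> nat \<Rightarrow> nat \<Rightarrow> real" where
  "output_prob A X T v =
     (\<Sum>t\<le>T. \<Sum>s\<in>{s \<in> basis A (length X). outcome A s = Some v}. (cmod (run A X t s))\<^sup>2)"

definition texts :: "nat \<Rightarrow> nat \<Rightarrow> nat list set" where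
  "texts n \<sigma> = {X. length X = n \<and> set X \<subseteq> {..<\<sigma>}}"

text \<open>
  \<open>q z\<close> bounds the number of queries on texts with \<open>z\<close> phrases.  No requirement is made on texts
  whose number of phrases is outside \<open>Z\<close>.
\<close>

definition computes_lz77_size ::
    "query_algorithm \<Rightarrow> nat \<Rightarrow> nat \<Rightarrow> nat set \<Rightarrow> (nat \<Rightarrow> nat) \<Rightarrow> bool" where
  "computes_lz77_size A n \<sigma> Z q \<longleftrightarrow>
     (\<forall>X\<in>texts n \<sigma>. lz77_size X \<in> Z \<longrightarrow>
        output_prob A X (q (lz77_size X)) (lz77_size X) \<ge> 2 / 3)"

definition size_range :: "real \<Rightarrow> real \<Rightarrow> nat \<Rightarrow> nat set" where
  "size_range \<xi> \<epsilon> n =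
     (let t = real n powr \<xi> in {z. t powr (1 - \<epsilon>) \<le> real z \<and> real z \<le> t})"

end

theory Submission
  imports Defs "HOL-Real_Asymp.Real_Asymp"
begin

text \<open>
  Write a fresh character into each slot of a set \<open>S\<close> of \<open>m\<close> slots, the slots being separated by
  zeros and preceded by a longer run of zeros.  Every fresh character is a phrase, and so is every
  maximal run of zeros after one, whence \<open>z = 2 + 2 |S|\<close>.  So the algorithm tells \<open>k\<close> from \<open>k + 1\<close>
  marked slots, which takes a constant times \<open>sqrt ((m - k) (k + 1))\<close> queries by Ambainis'
  adversary argument: averaged over the pairs of texts with \<open>k\<close> and \<open>k + 1\<close> marks that differ in
  one slot, the inner product of the two runs starts at 1, has to drop to \<open>17/18\<close>, and changes by
  at most \<open>2 / sqrt ((m - k) (k + 1))\<close> in a query.  Taking \<open>m\<close> linear in \<open>n\<close>, which the alphabet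
  permits, and \<open>k\<close> near \<open>n powr \<xi> / 4\<close> gives the theorem.
\<close>

section \<open>Inner products and unitary operators\<close>

definition inner_on :: "'b set \<Rightarrow> ('b \<Rightarrow> complex) \<Rightarrow> ('b \<Rightarrow> complex) \<Rightarrow> complex" where
  "inner_on B \<phi> \<psi> = (\<Sum>s\<in>B. cnj (\<phi> s) * \<psi> s)"

lemma inner_on_self: "inner_on B \<phi> \<phi> = of_real (\<Sum>s\<in>B. (cmod (\<phi> s))\<^sup>2)"
  unfolding inner_on_def of_real_sum
  by (intro sum.cong refl) (metis complex_norm_square mult.commute)

text \<open>A linearised Cauchy-Schwarz inequality, by weighted AM-GM in each coordinate. Being
  linear in the squared norms, it can be summed over times and over pairs of texts with one common
  weight.\<close>

lemma norm_inner_on_le: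
  assumes "\<mu> > 0"
  shows "cmod (inner_on B \<phi> \<psi>)
    \<le> (\<mu> * (\<Sum>s\<in>B. (cmod (\<phi> s))\<^sup>2) + (\<Sum>s\<in>B. (cmod (\<psi> s))\<^sup>2) / \<mu>) / 2"
proof -
  have am_gm: "x * y \<le> (\<mu> * x\<^sup>2 + y\<^sup>2 / \<mu>) / 2" for x y :: real
  proof -
    have "0 \<le> (\<mu> * x - y)\<^sup>2 / \<mu>"
      using assms by simp
    also have "\<dots> = \<mu> * x\<^sup>2 + y\<^sup>2 / \<mu> - 2 * (x * y)"
      using assms by (simp add: field_simps power2_eq_square)
    finally show ?thesis by simp
  qed
  have "cmod (inner_on B \<phi> \<psi>) \<le> (\<Sum>s\<in>B. cmod (\<phi> s) * cmod (\<psi> s))"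
    unfolding inner_on_def by (rule order_trans[OF norm_sum]) (simp add: norm_mult)
  also have "\<dots> \<le> (\<Sum>s\<in>B. (\<mu> * (cmod (\<phi> s))\<^sup>2 + (cmod (\<psi> s))\<^sup>2 / \<mu>) / 2)"
    by (intro sum_mono am_gm)
  also have "\<dots> = (\<mu> * (\<Sum>s\<in>B. (cmod (\<phi> s))\<^sup>2) + (\<Sum>s\<in>B. (cmod (\<psi> s))\<^sup>2) / \<mu>) / 2"
    by (simp add: sum.distrib sum_distrib_left sum_divide_distrib add_divide_distrib)
  finally show ?thesis .
qed

lemma inner_on_Un:
  "finite B \<Longrightarrow> finite C \<Longrightarrow> B \<inter> C = {} \<Longrightarrow>
    inner_on (B \<union> C) \<phi> \<psi> = inner_on B \<phi> \<psi> + inner_on C \<phi> \<psi>"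
  unfolding inner_on_def by (rule sum.union_disjoint)

text \<open>\<open>unitary_on\<close> says that the columns are orthonormal: moving the sum over
  \<open>q\<close> innermost turns it into a Kronecker delta.\<close>

lemma inner_on_apply_op:
  assumes "finite B" "unitary_on B U"
  shows "inner_on B (apply_op B U \<phi>) (apply_op B U \<psi>) = inner_on B \<phi> \<psi>"
proof -
  have "inner_on B (apply_op B U \<phi>) (apply_op B U \<psi>) =
      (\<Sum>q\<in>B. \<Sum>r\<in>B. \<Sum>s\<in>B. cnj (\<phi> r) * \<psi> s * (cnj (U q r) * U q s))"
    unfolding inner_on_def apply_op_def cnj_sum sum_product
    by (intro sum.cong refl) (simp add: mult_ac)
  also have "\<dots> = (\<Sum>r\<in>B. \<Sum>q\<in>B. \<Sum>s\<in>B. cnj (\<phi> r) * \<psi> s * (cnj (U q r) * U q s))"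
    by (rule sum.swap)
  also have "\<dots> = (\<Sum>r\<in>B. \<Sum>s\<in>B. \<Sum>q\<in>B. cnj (\<phi> r) * \<psi> s * (cnj (U q r) * U q s))"
    by (intro sum.cong refl sum.swap)
  also have "\<dots> = (\<Sum>r\<in>B. \<Sum>s\<in>B. cnj (\<phi> r) * \<psi> s * (if r = s then 1 else 0))"
    using assms(2) by (intro sum.cong refl) (simp add: sum_distrib_left[symmetric] unitary_on_def)
  also have "\<dots> = inner_on B \<phi> \<psi>"
    unfolding inner_on_def using assms(1)
    by (intro sum.cong refl) (simp add: if_distrib[of "\<lambda>x. _ * x"] cong: if_cong)
  finally show ?thesis .
qed

section \<open>Basis states by query position, and the oracle\<close>

lemma finite_basis [simp]: "finite (basis A n)"
  by (simp add: basis_def)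

lemma xor_less_two_power:
  fixes a b :: nat
  assumes "a < 2 ^ k" "b < 2 ^ k"
  shows "Bit_Operations.xor a b < 2 ^ k"
  using assms by (metis take_bit_nat_eq_self_iff take_bit_xor)

text \<open>Used for a single position, for its complement and for \<open>UNIV\<close>: oracles of
  texts that differ in one position act alike on the complement.\<close>

definition positions_in :: "query_algorithm \<Rightarrow> nat \<Rightarrow> nat set \<Rightarrow> basis_state set" where
  "positions_in A n P = {s \<in> basis A n. fst s \<in> P}"

lemma finite_positions_in [simp]: "finite (positions_in A n P)"
  by (simp add: positions_in_def)

text \<open>An oracle call keeps the position and is an involution of these basis states; XOR stays
  within the answer register because all characters fit into it.\<close>

lemma sum_oracle_call:
  fixes g :: "basis_state \<Rightarrow> 'c::comm_monoid_add"
  assumes "valid_algorithm A n \<sigma>" "X \<in> texts n \<sigma>"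
  shows "(\<Sum>(i, b, w)\<in>positions_in A n P. g (i, Bit_Operations.xor b (X ! i), w)) =
    sum g (positions_in A n P)"
proof (rule sum.reindex_bij_witness[where
      i = "\<lambda>(i, b, w). (i, Bit_Operations.xor b (X ! i), w)" and
      j = "\<lambda>(i, b, w). (i, Bit_Operations.xor b (X ! i), w)"])
  have "X ! i < 2 ^ answer_bits A" if "i < n" for i
  proof -
    have "X ! i \<in> set X" "set X \<subseteq> {..<\<sigma>}"
      using assms(2) that by (auto simp: texts_def)
    then have "X ! i < \<sigma>" by auto
    with assms(1) show ?thesis by (simp add: valid_algorithm_def)
  qed
  then show "(case s of (i, b, w) \<Rightarrow> (i, Bit_Operations.xor b (X ! i), w)) \<in> positions_in A n P"
    if "s \<in> positions_in A n P" for s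
    using that by (auto simp: positions_in_def basis_def xor_less_two_power)
  then show "(case s of (i, b, w) \<Rightarrow> (i, Bit_Operations.xor b (X ! i), w)) \<in> positions_in A n P"
    if "s \<in> positions_in A n P" for s
    using that .
qed (auto simp: xor.assoc)

lemma inner_on_oracle_call:
  assumes "valid_algorithm A n \<sigma>" "X \<in> texts n \<sigma>"
    and "\<And>i. i < n \<Longrightarrow> i \<in> P \<Longrightarrow> X ! i = Y ! i"
  shows "inner_on (positions_in A n P) (oracle_call X \<phi>) (oracle_call Y \<psi>) =
    inner_on (positions_in A n P) \<phi> \<psi>"
proof -
  have "inner_on (positions_in A n P) (oracle_call X \<phi>) (oracle_call Y \<psi>) =
      (\<Sum>(i, b, w)\<in>positions_in A n P. (\<lambda>s. cnj (\<phi> s) * \<psi> s) (i, Bit_Operations.xor b (X ! i), w))"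
    unfolding inner_on_def oracle_call_def
    by (intro sum.cong refl) (auto simp: positions_in_def basis_def assms(3))
  also have "\<dots> = inner_on (positions_in A n P) \<phi> \<psi>"
    unfolding inner_on_def by (rule sum_oracle_call[OF assms(1,2)])
  finally show ?thesis .
qed

lemma sum_norm_oracle_call:
  assumes "valid_algorithm A n \<sigma>" "X \<in> texts n \<sigma>"
  shows "(\<Sum>s\<in>positions_in A n P. (cmod (oracle_call X \<phi> s))\<^sup>2) =
    (\<Sum>s\<in>positions_in A n P. (cmod (\<phi> s))\<^sup>2)"
  using inner_on_oracle_call[OF assms, of P X \<phi> \<phi>] by (simp only: inner_on_self of_real_eq_iff)

section \<open>Overlaps and masses of runs that may halt\<close>

definition halted_overlap ::
    "query_algorithm \<Rightarrow> nat \<Rightarrow> nat list \<Rightarrow> nat list \<Rightarrow> nat option set \<Rightarrow> nat \<Rightarrow> complex" where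
  "halted_overlap A n X Y V T =
     (\<Sum>t\<le>T. inner_on {s \<in> basis A n. outcome A s \<in> V} (run A X t) (run A Y t))"

text \<open>
  The halted parts of both runs enter the overlap because halting would otherwise change the
  inner product as well; with them, only oracle calls do.
\<close>

definition overlap :: "query_algorithm \<Rightarrow> nat \<Rightarrow> nat list \<Rightarrow> nat list \<Rightarrow> nat \<Rightarrow> complex" where
  "overlap A n X Y T =
     halted_overlap A n X Y (- {None}) T +
     inner_on (basis A n) (continue_part A (run A X T)) (continue_part A (run A Y T))"

lemma inner_on_continue_part:
  "inner_on (basis A n) (continue_part A \<phi>) (continue_part A \<psi>) =
   inner_on {s \<in> basis A n. outcome A s = None} \<phi> \<psi>"
  unfolding inner_on_def
  by (rule sum.mono_neutral_cong_right) (auto simp: continue_part_def)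

lemma inner_on_halt_or_continue:
  "inner_on {s \<in> basis A n. outcome A s \<in> - {None}} \<phi> \<psi> +
   inner_on (basis A n) (continue_part A \<phi>) (continue_part A \<psi>) = inner_on (basis A n) \<phi> \<psi>"
  unfolding inner_on_continue_part
  by (subst inner_on_Un[symmetric]) (auto intro: arg_cong[of _ _ "\<lambda>B. inner_on B \<phi> \<psi>"])

lemma overlap_0:
  assumes "valid_algorithm A n \<sigma>" "n \<ge> 1" "length X = n" "length Y = n"
  shows "overlap A n X Y 0 = 1"
proof -
  have "(0, 0, 0) \<in> basis A n"
    using assms(1,2) by (auto simp: basis_def valid_algorithm_def)
  then have "inner_on (basis A n) (ket (0, 0, 0)) (ket (0, 0, 0)) = 1"
    by (simp add: inner_on_def ket_def if_distrib[of cnj] if_distrib[of "\<lambda>x. x * _"] cong: if_cong)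
  moreover have "overlap A n X Y 0 = inner_on (basis A n) (run A X 0) (run A Y 0)"
    using inner_on_halt_or_continue[of A n "run A X 0" "run A Y 0"]
    by (simp only: overlap_def halted_overlap_def atMost_0 sum.insert sum.empty finite.emptyI
        empty_iff not_False_eq_True add_0_right)
  ultimately show ?thesis
    using assms by (simp add: inner_on_apply_op valid_algorithm_def)
qed

text \<open>The newly halted and the continuing part recombine to the inner product before the
  measurement, which equals the one before the unitary; what is left is the effect of the
  query.\<close>

lemma overlap_Suc:
  assumes "valid_algorithm A n \<sigma>" "length X = n" "length Y = n"
  shows "overlap A n X Y (Suc T) - overlap A n X Y T =
    inner_on (basis A n) (oracle_call X (continue_part A (run A X T)))
      (oracle_call Y (continue_part A (run A Y T))) -
    inner_on (basis A n) (continue_part A (run A X T)) (continue_part A (run A Y T))"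
proof -
  have "overlap A n X Y (Suc T) = halted_overlap A n X Y (- {None}) T +
      inner_on (basis A n) (run A X (Suc T)) (run A Y (Suc T))"
    unfolding overlap_def halted_overlap_def sum.atMost_Suc add.assoc inner_on_halt_or_continue ..
  then show ?thesis
    using assms by (simp add: overlap_def inner_on_apply_op valid_algorithm_def)
qed

lemma basis_eq_positions_in: "basis A n = positions_in A n UNIV"
  by (simp add: positions_in_def)

text \<open>For equal texts the overlap is the total probability of all branches, so this is
  conservation of probability, used as such in \<open>total_mass\<close>.\<close>

lemma overlap_self:
  assumes "valid_algorithm A n \<sigma>" "X \<in> texts n \<sigma>" "n \<ge> 1"
  shows "overlap A n X X T = 1"
proof (induction T)
  case 0
  then show ?case using assms by (auto intro: overlap_0 simp: texts_def)
next
  case (Suc T)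
  have "overlap A n X X (Suc T) - overlap A n X X T = 0"
    using assms by (subst overlap_Suc)
      (auto simp: basis_eq_positions_in inner_on_oracle_call texts_def)
  with Suc show ?case by simp
qed

text \<open>The query magnitude of \<open>p\<close>: the probability of not having halted and of
  addressing \<open>p\<close>. Index \<open>t\<close> is the state after the unitary
  \<open>step A t\<close>, so the query concerned is number \<open>Suc t\<close>.\<close>

definition query_mass :: "query_algorithm \<Rightarrow> nat \<Rightarrow> nat list \<Rightarrow> nat \<Rightarrow> nat \<Rightarrow> real" where
  "query_mass A n X t p = (\<Sum>s\<in>positions_in A n {p}. (cmod (continue_part A (run A X t) s))\<^sup>2)"

lemma query_mass_nonneg: "query_mass A n X t p \<ge> 0"
  unfolding query_mass_def by (intro sum_nonneg) simp

definition halted_mass :: "query_algorithm \<Rightarrow> nat \<Rightarrow> nat list \<Rightarrow> nat option set \<Rightarrow> nat \<Rightarrow> real" where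
  "halted_mass A n X V T =
     (\<Sum>t\<le>T. \<Sum>s\<in>{s \<in> basis A n. outcome A s \<in> V}. (cmod (run A X t s))\<^sup>2)"

lemma halted_mass_nonneg: "halted_mass A n X V T \<ge> 0"
  unfolding halted_mass_def by (intro sum_nonneg) simp

lemma halted_overlap_self: "halted_overlap A n X X V T = of_real (halted_mass A n X V T)"
  by (simp add: halted_overlap_def halted_mass_def inner_on_self)

lemma halted_mass_output_prob:
  "length X = n \<Longrightarrow> halted_mass A n X {Some v} T = output_prob A X T v"
  by (simp add: halted_mass_def output_prob_def)

lemma inner_on_outcome_Un:
  assumes "V \<inter> W = {}"
  shows "inner_on {s \<in> basis A n. outcome A s \<in> V \<union> W} \<phi> \<psi> =
    inner_on {s \<in> basis A n. outcome A s \<in> V} \<phi> \<psi> + inner_on {s \<in> basis A n. outcome A s \<in> W} \<phi> \<psi>"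
  using assms
  by (subst inner_on_Un[symmetric]) (auto intro: arg_cong[of _ _ "\<lambda>B. inner_on B \<phi> \<psi>"])

lemma halted_overlap_Un:
  assumes "V \<inter> W = {}"
  shows "halted_overlap A n X Y (V \<union> W) T = halted_overlap A n X Y V T + halted_overlap A n X Y W T"
  unfolding halted_overlap_def by (simp only: inner_on_outcome_Un[OF assms] sum.distrib)

lemma halted_mass_Un:
  assumes "V \<inter> W = {}"
  shows "halted_mass A n X (V \<union> W) T = halted_mass A n X V T + halted_mass A n X W T"
  using halted_overlap_Un[OF assms, of A n X X T]
  by (simp only: halted_overlap_self of_real_add[symmetric] of_real_eq_iff)

lemma norm_halted_overlap_le:
  assumes "\<mu> > 0"
  shows "cmod (halted_overlap A n X Y V T)
    \<le> (\<mu> * halted_mass A n X V T + halted_mass A n Y V T / \<mu>) / 2"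
proof -
  have "cmod (halted_overlap A n X Y V T) \<le>
      (\<Sum>t\<le>T. (\<mu> * (\<Sum>s\<in>{s \<in> basis A n. outcome A s \<in> V}. (cmod (run A X t s))\<^sup>2) +
        (\<Sum>s\<in>{s \<in> basis A n. outcome A s \<in> V}. (cmod (run A Y t s))\<^sup>2) / \<mu>) / 2)"
    unfolding halted_overlap_def
    by (rule order_trans[OF norm_sum]) (intro sum_mono norm_inner_on_le assms)
  also have "\<dots> = (\<mu> * halted_mass A n X V T + halted_mass A n Y V T / \<mu>) / 2"
    unfolding halted_mass_def
    by (simp only: sum.distrib sum_distrib_left sum_divide_distrib add_divide_distrib)
  finally show ?thesis .
qed

section \<open>Conservation of probability and the adversary bound\<close>

lemma total_mass:
  assumes "valid_algorithm A n \<sigma>" "X \<in> texts n \<sigma>" "n \<ge> 1"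
  shows "halted_mass A n X (- {None}) T +
    (\<Sum>s\<in>basis A n. (cmod (continue_part A (run A X T) s))\<^sup>2) = 1"
proof -
  have "complex_of_real (halted_mass A n X (- {None}) T +
      (\<Sum>s\<in>basis A n. (cmod (continue_part A (run A X T) s))\<^sup>2)) = of_real 1"
    using overlap_self[OF assms, of T]
    unfolding overlap_def halted_overlap_self inner_on_self of_real_add by simp
  then show ?thesis by (simp only: of_real_eq_iff)
qed

lemma sum_query_mass_le_1:
  assumes "valid_algorithm A n \<sigma>" "X \<in> texts n \<sigma>" "n \<ge> 1"
  shows "(\<Sum>p<n. query_mass A n X t p) \<le> 1"
proof -
  have "(\<Sum>p<n. query_mass A n X t p) =
      (\<Sum>s\<in>basis A n. (cmod (continue_part A (run A X t) s))\<^sup>2)"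
    unfolding query_mass_def positions_in_def singleton_iff
    by (rule sum.group) (auto simp: basis_def)
  then show ?thesis
    using total_mass[OF assms, of t] halted_mass_nonneg[of A n X "- {None}" t] by linarith
qed

text \<open>Away from \<open>p\<close> the oracles agree and the contributions cancel. At
  \<open>p\<close> the inner products before and after the query are bounded separately, each giving
  half of the right-hand side.\<close>

lemma overlap_step_le:
  assumes "valid_algorithm A n \<sigma>" "X \<in> texts n \<sigma>" "Y \<in> texts n \<sigma>"
    and "\<And>i. i < n \<Longrightarrow> i \<noteq> p \<Longrightarrow> X ! i = Y ! i" and "\<mu> > 0"
  shows "cmod (overlap A n X Y (Suc t) - overlap A n X Y t)
    \<le> \<mu> * query_mass A n X t p + query_mass A n Y t p / \<mu>"
proof -
  define \<phi> \<psi> where "\<phi> = continue_part A (run A X t)" and "\<psi> = continue_part A (run A Y t)"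
  have split: "inner_on (basis A n) f g =
      inner_on (positions_in A n {p}) f g + inner_on (positions_in A n (- {p})) f g" for f g
    by (subst inner_on_Un[symmetric])
      (auto intro: arg_cong[of _ _ "\<lambda>B. inner_on B f g"] simp: positions_in_def)
  have "inner_on (positions_in A n (- {p})) (oracle_call X \<phi>) (oracle_call Y \<psi>) =
      inner_on (positions_in A n (- {p})) \<phi> \<psi>"
    using assms(4) by (intro inner_on_oracle_call[OF assms(1,2)]) auto
  then have "overlap A n X Y (Suc t) - overlap A n X Y t =
      inner_on (positions_in A n {p}) (oracle_call X \<phi>) (oracle_call Y \<psi>) -
      inner_on (positions_in A n {p}) \<phi> \<psi>"
    using assms(1-3) by (subst overlap_Suc) (auto simp: split texts_def \<phi>_def \<psi>_def)
  then have "cmod (overlap A n X Y (Suc t) - overlap A n X Y t) \<le>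
      cmod (inner_on (positions_in A n {p}) (oracle_call X \<phi>) (oracle_call Y \<psi>)) +
      cmod (inner_on (positions_in A n {p}) \<phi> \<psi>)"
    using norm_triangle_ineq4 by metis
  moreover have "cmod (inner_on (positions_in A n {p}) (oracle_call X \<phi>) (oracle_call Y \<psi>)) \<le>
      (\<mu> * query_mass A n X t p + query_mass A n Y t p / \<mu>) / 2"
    using norm_inner_on_le[OF assms(5), of "positions_in A n {p}" "oracle_call X \<phi>" "oracle_call Y \<psi>"]
    unfolding sum_norm_oracle_call[OF assms(1,2)] sum_norm_oracle_call[OF assms(1,3)]
    by (simp add: query_mass_def \<phi>_def \<psi>_def)
  moreover have "cmod (inner_on (positions_in A n {p}) \<phi> \<psi>) \<le>
      (\<mu> * query_mass A n X t p + query_mass A n Y t p / \<mu>) / 2"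
    using norm_inner_on_le[OF assms(5), of "positions_in A n {p}" \<phi> \<psi>]
    by (simp add: query_mass_def \<phi>_def \<psi>_def)
  ultimately show ?thesis by simp
qed

text \<open>Branches that answer \<open>u\<close> carry at least 2/3 of the mass of \<open>X\<close>
  but at most 1/3 of that of \<open>Y\<close>, so the runs are far from parallel. The part still
  running is treated like the other answers.\<close>

lemma overlap_final_le:
  assumes A: "valid_algorithm A n \<sigma>" and n: "n \<ge> 1"
    and X: "X \<in> texts n \<sigma>" "output_prob A X T u \<ge> 2 / 3"
    and Y: "Y \<in> texts n \<sigma>" "output_prob A Y T v \<ge> 2 / 3"
    and "u \<noteq> v"
  shows "cmod (overlap A n X Y T) \<le> 17 / 18"
proof -
  have len: "length X = n" "length Y = n" using X Y by (auto simp: texts_def)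
  define W where "W = - {None, Some u}"
  define \<phi> \<psi> where "\<phi> = continue_part A (run A X T)" and "\<psi> = continue_part A (run A Y T)"
  define x y where "x = (\<Sum>s\<in>basis A n. (cmod (\<phi> s))\<^sup>2)" and "y = (\<Sum>s\<in>basis A n. (cmod (\<psi> s))\<^sup>2)"
  have W: "- {None} = {Some u} \<union> W" "{Some u} \<inter> W = {}"
    "W = {Some v} \<union> (W - {Some v})" "{Some v} \<inter> (W - {Some v}) = {}"
    using \<open>u \<noteq> v\<close> by (auto simp: W_def)
  define p r p' r' where "p = halted_mass A n X {Some u} T" and "r = halted_mass A n Y {Some u} T"
    and "p' = halted_mass A n X W T" and "r' = halted_mass A n Y W T"
  have "p \<ge> 2 / 3"
    using X by (simp add: p_def halted_mass_output_prob len)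
  have p: "p + p' + x = 1"
    using total_mass[OF A X(1) n, of T] unfolding W(1) halted_mass_Un[OF W(2)]
    by (simp add: p_def p'_def x_def \<phi>_def)
  have r: "r + r' + y = 1"
    using total_mass[OF A Y(1) n, of T] unfolding W(1) halted_mass_Un[OF W(2)]
    by (simp add: r_def r'_def y_def \<psi>_def)
  have "r' = output_prob A Y T v + halted_mass A n Y (W - {Some v}) T"
    unfolding r'_def by (subst W(3), subst halted_mass_Un[OF W(4)])
      (simp add: halted_mass_output_prob len)
  then have "r' \<ge> 2 / 3"
    using Y(2) halted_mass_nonneg[of A n Y "W - {Some v}" T] by linarith
  have "y \<ge> 0" unfolding y_def by (intro sum_nonneg) simp
  have "overlap A n X Y T =
      halted_overlap A n X Y {Some u} T + halted_overlap A n X Y W T + inner_on (basis A n) \<phi> \<psi>"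
    unfolding overlap_def W(1) halted_overlap_Un[OF W(2)] \<phi>_def \<psi>_def ..
  then have "cmod (overlap A n X Y T) \<le> cmod (halted_overlap A n X Y {Some u} T) +
      cmod (halted_overlap A n X Y W T) + cmod (inner_on (basis A n) \<phi> \<psi>)"
    by (metis norm_triangle_mono norm_triangle_ineq order_refl)
  \<comment> \<open>The weight 3/4 where \<open>X\<close> has most of its mass, 4/3 elsewhere, is near the optimum
      \<open>sqrt (1/2)\<close>; equal weights would only give the trivial bound 1.\<close>
  also have "\<dots> \<le> (3/4 * p + r / (3/4)) / 2 + (4/3 * p' + r' / (4/3)) / 2 + (4/3 * x + y / (4/3)) / 2"
    unfolding p_def r_def p'_def r'_def x_def y_def
    by (intro add_mono norm_halted_overlap_le norm_inner_on_le) auto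
  \<comment> \<open>By conservation of mass the sum equals \<open>25/24 - 7/24 * (p - r)\<close>,
    and \<open>p - r\<close> is at least 1/3.\<close>
  also have "\<dots> \<le> 17 / 18"
    using p r \<open>p \<ge> 2 / 3\<close> \<open>r' \<ge> 2 / 3\<close> \<open>y \<ge> 0\<close> by (simp add: field_simps)
  finally show ?thesis .
qed

text \<open>\<open>E\<close> is the edge set of a bipartite graph, an edge joining texts that differ
  at most at \<open>pos\<close>; \<open>a\<close> and \<open>b\<close> bound the average degrees of
  the two sides from below. Injectivity makes a text and a position determine the edge.\<close>

lemma adversary_bound:
  fixes src tgt :: "'e \<Rightarrow> nat list" and pos :: "'e \<Rightarrow> nat" and a b :: real
  assumes A: "valid_algorithm A n \<sigma>" and n: "n \<ge> 1"
    and fin: "finite \<X>" "finite \<Y>" "finite E" and "E \<noteq> {}"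
    and sub: "\<X> \<subseteq> texts n \<sigma>" "\<Y> \<subseteq> texts n \<sigma>" "src ` E \<subseteq> \<X>" "tgt ` E \<subseteq> \<Y>" "pos ` E \<subseteq> {..<n}"
    and inj: "inj_on (\<lambda>e. (src e, pos e)) E" "inj_on (\<lambda>e. (tgt e, pos e)) E"
    and diff: "\<And>e i. e \<in> E \<Longrightarrow> i < n \<Longrightarrow> i \<noteq> pos e \<Longrightarrow> src e ! i = tgt e ! i"
    and out: "\<And>X. X \<in> \<X> \<Longrightarrow> output_prob A X T u \<ge> 2 / 3"
      "\<And>Y. Y \<in> \<Y> \<Longrightarrow> output_prob A Y T v \<ge> 2 / 3" and "u \<noteq> v"
    and deg: "a > 0" "b > 0" "a * card \<X> \<le> card E" "b * card \<Y> \<le> card E"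
  shows "sqrt (a * b) \<le> 36 * real T"
proof -
  \<comment> \<open>This weight makes \<open>\<mu> / a\<close> and \<open>1 / (b * \<mu>)\<close>
    equal, both being \<open>1 / sqrt (a * b)\<close>.\<close>
  define \<mu> where "\<mu> = sqrt (a / b)"
  have "\<mu> > 0" using deg by (simp add: \<mu>_def)
  \<comment> \<open>No pair of a text and a position occurs on two edges, so the sum is part of the
    query mass of all texts, which is at most 1 for each.\<close>
  have mass: "(\<Sum>e\<in>E. query_mass A n (f e) t (pos e)) \<le> card \<Z>"
    if "finite \<Z>" "\<Z> \<subseteq> texts n \<sigma>" "f ` E \<subseteq> \<Z>" "inj_on (\<lambda>e. (f e, pos e)) E"
    for f \<Z> t
  proof -
    have "(\<Sum>e\<in>E. query_mass A n (f e) t (pos e)) =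
        (\<Sum>(X, p)\<in>(\<lambda>e. (f e, pos e)) ` E. query_mass A n X t p)"
      using that(4) by (simp add: sum.reindex)
    also have "\<dots> \<le> (\<Sum>(X, p)\<in>\<Z> \<times> {..<n}. query_mass A n X t p)"
      using that sub(5) by (intro sum_mono2) (auto simp: query_mass_nonneg)
    also have "\<dots> = (\<Sum>X\<in>\<Z>. \<Sum>p<n. query_mass A n X t p)"
      by (simp add: sum.cartesian_product)
    also have "\<dots> \<le> (\<Sum>X\<in>\<Z>. 1)"
      using that(2) by (intro sum_mono sum_query_mass_le_1[OF A _ n]) auto
    finally show ?thesis by simp
  qed
  define S where "S t = (\<Sum>e\<in>E. overlap A n (src e) (tgt e) t)" for t
  have step: "cmod (S (Suc t) - S t) \<le> 2 * card E / sqrt (a * b)" for t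
  proof -
    have "cmod (S (Suc t) - S t) \<le>
        (\<Sum>e\<in>E. \<mu> * query_mass A n (src e) t (pos e) + query_mass A n (tgt e) t (pos e) / \<mu>)"
      unfolding S_def sum_subtractf[symmetric]
      using sub by (intro sum_norm_le overlap_step_le[OF A _ _ diff \<open>\<mu> > 0\<close>]) auto
    also have "\<dots> = \<mu> * (\<Sum>e\<in>E. query_mass A n (src e) t (pos e)) +
        (\<Sum>e\<in>E. query_mass A n (tgt e) t (pos e)) / \<mu>"
      by (simp add: sum.distrib sum_distrib_left sum_divide_distrib)
    also have "\<dots> \<le> \<mu> * card \<X> + card \<Y> / \<mu>"
      using mass[OF fin(1) sub(1,3) inj(1)] mass[OF fin(2) sub(2,4) inj(2)] \<open>\<mu> > 0\<close>
      by (intro add_mono mult_left_mono divide_right_mono) auto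
    also have "\<dots> \<le> \<mu> * (card E / a) + (card E / b) / \<mu>"
      using deg \<open>\<mu> > 0\<close>
      by (intro add_mono mult_left_mono divide_right_mono) (auto simp: field_simps)
    also have "\<dots> = 2 * card E / sqrt (a * b)"
    proof -
      have "\<mu> / a = 1 / sqrt (a * b)" "1 / (b * \<mu>) = 1 / sqrt (a * b)"
        using deg by (simp_all add: \<mu>_def real_sqrt_divide real_sqrt_mult field_simps)
      then have "card E * (\<mu> / a) + card E * (1 / (b * \<mu>)) = 2 * card E / sqrt (a * b)"
        by simp
      then show ?thesis by (simp add: mult_ac)
    qed
    finally show ?thesis .
  qed
  have tele: "cmod (S t - S 0) \<le> t * (2 * card E / sqrt (a * b))" for t
  proof (induction t)
    case (Suc t)
    have "S (Suc t) - S 0 = (S (Suc t) - S t) + (S t - S 0)" by simp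
    then have "cmod (S (Suc t) - S 0) \<le> cmod (S (Suc t) - S t) + cmod (S t - S 0)"
      by (metis norm_triangle_ineq)
    with step[of t] Suc show ?case by (simp add: algebra_simps add_divide_distrib)
  qed simp
  have "S 0 = card E"
    using sub overlap_0[OF A n] by (auto simp: S_def texts_def image_subset_iff subset_iff)
  moreover have "cmod (S T) \<le> (\<Sum>e\<in>E. 17 / 18)"
    unfolding S_def using sub
    by (intro sum_norm_le overlap_final_le[OF A n _ out(1) _ out(2) \<open>u \<noteq> v\<close>]) auto
  ultimately have "card E / 18 \<le> cmod (S T - S 0)"
    using norm_triangle_ineq2[of "S 0" "S T"] by (simp add: norm_minus_commute)
  \<comment> \<open>\<open>S\<close> has to move by \<open>card E / 18\<close>, while a query moves
    it by at most \<open>2 * card E / sqrt (a * b)\<close>; hence the constant 36.\<close>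
  with tele[of T] have "card E / 18 \<le> T * (2 * card E / sqrt (a * b))" by linarith
  moreover have "card E > 0" using fin(3) \<open>E \<noteq> {}\<close> by (simp add: card_gt_0_iff)
  ultimately show ?thesis using deg by (simp add: field_simps)
qed


section \<open>LZ77 parsing of zeros with isolated fresh characters\<close>

lemma previous_occurrence_iff_nth:
  "previous_occurrence X i l \<longleftrightarrow>
    i + l \<le> length X \<and> (\<exists>j<i. \<forall>d<l. X ! (j + d) = X ! (i + d))"
  by (auto simp: previous_occurrence_def list_eq_iff_nth_eq min_def)

lemma previous_occurrence_mono:
  "previous_occurrence X i l \<Longrightarrow> l' \<le> l \<Longrightarrow> previous_occurrence X i l'"
  by (fastforce simp: previous_occurrence_iff_nth)

text \<open>Prefixes of a repeated fragment are repeated, so failure at \<open>Suc l\<close>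
  excludes all greater lengths.\<close>

lemma phrase_length_eqI:
  assumes "l \<ge> 1" "previous_occurrence X i l" "\<not> previous_occurrence X i (Suc l)"
  shows "phrase_length X i = l"
proof -
  have "(GREATEST l. previous_occurrence X i l) = l"
    using assms previous_occurrence_mono[of X i _ "Suc l"]
    by (intro Greatest_equality) (auto simp flip: not_less_eq_eq)
  with assms show ?thesis by (auto simp: phrase_length_def)
qed

lemma phrase_length_fresh:
  assumes "\<And>j. j < i \<Longrightarrow> X ! j \<noteq> X ! i"
  shows "phrase_length X i = 1"
  using assms by (force simp: phrase_length_def previous_occurrence_iff_nth)

text \<open>The first half consists of zeros and is a source for every later run of zeros; a zero
  after each nonzero character, also after the last, makes each of them start exactly two phrases;
  freshness stops every copy.\<close>

locale sparse_text =
  fixes X :: "nat list"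
  assumes zero_half: "i < length X \<Longrightarrow> X ! i \<noteq> 0 \<Longrightarrow> length X \<le> 2 * i"
    and isolated: "i < length X \<Longrightarrow> X ! i \<noteq> 0 \<Longrightarrow> Suc i < length X \<and> X ! Suc i = 0"
    and fresh: "i < length X \<Longrightarrow> X ! i \<noteq> 0 \<Longrightarrow> j < i \<Longrightarrow> X ! j \<noteq> X ! i"
begin

text \<open>The source is position \<open>p - 1\<close> if that is a zero, an overlapping copy that
  occurs at \<open>p = 1\<close> in the parsing, and otherwise the start of the text. The phrase
  stops at \<open>e\<close>, which is the end of the text or holds a fresh character.\<close>

lemma phrase_length_zero_run:
  assumes "1 \<le> p" "p < e" "e \<le> length X"
    and run: "\<And>i. p \<le> i \<Longrightarrow> i < e \<Longrightarrow> X ! i = 0"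
    and "e = length X \<or> X ! e \<noteq> 0"
  shows "phrase_length X p = e - p"
proof (rule phrase_length_eqI)
  show "previous_occurrence X p (e - p)"
  proof (cases "X ! (p - 1) = 0")
    case True
    have "X ! (p - 1 + d) = X ! (p + d)" if "d < e - p" for d
      using that run[of "p + d"] run[of "p - 1 + d"] True assms(1) by (cases d) auto
    then show ?thesis
      using assms by (auto simp: previous_occurrence_iff_nth intro!: exI[of _ "p - 1"])
  next
    case False
    then have "length X \<le> 2 * (p - 1)" using zero_half[of "p - 1"] assms by auto
    have "X ! (0 + d) = X ! (p + d)" if "d < e - p" for d
    proof -
      have "X ! d = 0"
        using zero_half[of d] that \<open>length X \<le> 2 * (p - 1)\<close> assms(1,3) by fastforce
      with run[of "p + d"] that show ?thesis by simp
    qed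
    then show ?thesis
      using assms by (auto simp: previous_occurrence_iff_nth intro!: exI[of _ 0])
  qed
  show "\<not> previous_occurrence X p (Suc (e - p))"
  proof
    assume "previous_occurrence X p (Suc (e - p))"
    then obtain j where j: "e < length X" "j < p" "X ! (j + (e - p)) = X ! (p + (e - p))"
      using assms(2) by (auto simp: previous_occurrence_iff_nth)
    \<comment> \<open>The copy of \<open>X ! e\<close> in the earlier occurrence would lie before
      \<open>e\<close>, contrary to freshness.\<close>
    have "j + (e - p) < e" using j(2) assms(2) by linarith
    with j fresh[of e "j + (e - p)"] assms show False by auto
  qed
qed (use assms in auto)

text \<open>The summand 1 is the run of zeros in progress at \<open>p\<close>; each later nonzero
  character adds itself and the run after it.\<close>

lemma length_lz77_from:
  assumes "1 \<le> p" "p < length X"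
  shows "length (lz77_from X p) =
    (if X ! p = 0 then 1 else 0) + 2 * card {i \<in> {p..<length X}. X ! i \<noteq> 0}"
  using assms
proof (induction "length X - p" arbitrary: p rule: less_induct)
  case less
  define M where "M p = {i \<in> {p..<length X}. X ! i \<noteq> 0}" for p
  have [simp]: "finite (M p)" for p by (simp add: M_def)
  show ?case
  proof (cases "X ! p = 0")
    case False
    with less.prems isolated have p: "Suc p < length X" "X ! Suc p = 0" by auto
    have "M p = insert p (M (Suc p))" "p \<notin> M (Suc p)"
      using False less.prems by (auto simp: M_def Suc_le_eq order_le_less)
    moreover have "phrase_length X p = 1"
      using fresh[OF less.prems(2) False] by (rule phrase_length_fresh)
    moreover have "length (lz77_from X (Suc p)) = 1 + 2 * card (M (Suc p))"
      using less.hyps[of "Suc p"] p less.prems by (simp add: M_def)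
    ultimately show ?thesis
      using False less.prems unfolding M_def[symmetric] by (subst lz77_from.simps) simp
  next
    case True
    define e where "e = (LEAST e. p \<le> e \<and> (e = length X \<or> X ! e \<noteq> 0))"
    have e: "p \<le> e" "e = length X \<or> X ! e \<noteq> 0"
      using LeastI[of "\<lambda>e. p \<le> e \<and> (e = length X \<or> X ! e \<noteq> 0)" "length X"] less.prems
      by (auto simp: e_def)
    have "e \<le> length X"
      unfolding e_def using less.prems by (intro Least_le) auto
    have "p < e" using e True less.prems by (cases "p = e") auto
    have run: "X ! i = 0" if "p \<le> i" "i < e" for i
      using not_less_Least[of i "\<lambda>e. p \<le> e \<and> (e = length X \<or> X ! e \<noteq> 0)"] that
      by (auto simp: e_def)
    have "phrase_length X p = e - p"
      using phrase_length_zero_run[OF less.prems(1) \<open>p < e\<close> \<open>e \<le> length X\<close> run e(2)] .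
    then have "length (lz77_from X p) = 1 + length (lz77_from X e)"
      using less.prems \<open>p < e\<close> by (subst lz77_from.simps) simp
    moreover have "M p = M e"
      using run \<open>p < e\<close> unfolding M_def by (auto intro: leI)
    moreover have "length (lz77_from X e) = 2 * card (M e)"
    proof (cases "e = length X")
      case True
      then show ?thesis by (subst lz77_from.simps) (simp add: M_def)
    next
      case False
      then show ?thesis
        using less.hyps[of e] e \<open>p < e\<close> \<open>e \<le> length X\<close> less.prems by (simp add: M_def)
    qed
    ultimately show ?thesis using True unfolding M_def[symmetric] by simp
  qed
qed

lemma lz77_size_eq:
  assumes "length X \<ge> 3"
  shows "lz77_size X = 2 + 2 * card {i. i < length X \<and> X ! i \<noteq> 0}"
proof -
  \<comment> \<open>Length at least 3 puts positions 0 and 1 into the zero half. The zero at 0 and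
    the run starting at 1 are the two extra phrases.\<close>
  have zero: "X ! 0 = 0" "X ! 1 = 0"
    using zero_half[of 0] zero_half[of 1] assms by fastforce+
  have "phrase_length X 0 = 1" by (rule phrase_length_fresh) simp
  then have "lz77_size X = 1 + length (lz77_from X 1)"
    using assms unfolding lz77_size_def lz77_def by (subst lz77_from.simps) auto
  moreover have "{i \<in> {1..<length X}. X ! i \<noteq> 0} = {i. i < length X \<and> X ! i \<noteq> 0}"
    using zero(1) by (auto simp: Suc_le_eq intro: gr0I)
  ultimately show ?thesis using length_lz77_from[of 1] zero assms by simp
qed

end

section \<open>The family of marked texts\<close>

definition marked_text :: "nat \<Rightarrow> nat \<Rightarrow> nat set \<Rightarrow> nat list" where
  "marked_text L m S =
     map (\<lambda>p. if L \<le> p \<and> even (p - L) \<and> (p - L) div 2 \<in> S then Suc ((p - L) div 2) else 0)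
       [0..<L + 2 * m]"

lemma length_marked_text [simp]: "length (marked_text L m S) = L + 2 * m"
  by (simp add: marked_text_def)

lemma nth_marked_text:
  "p < L + 2 * m \<Longrightarrow> marked_text L m S ! p =
    (if L \<le> p \<and> even (p - L) \<and> (p - L) div 2 \<in> S then Suc ((p - L) div 2) else 0)"
  by (simp add: marked_text_def)

lemma marked_text_nonzeroE:
  assumes "p < L + 2 * m" "marked_text L m S ! p \<noteq> 0"
  obtains j where "j \<in> S" "j < m" "p = L + 2 * j" "marked_text L m S ! p = Suc j"
proof
  show "(p - L) div 2 \<in> S" "(p - L) div 2 < m" "p = L + 2 * ((p - L) div 2)"
    "marked_text L m S ! p = Suc ((p - L) div 2)"
    using assms by (auto simp: nth_marked_text split: if_splits)
qed

text \<open>\<open>2 * m <= L\<close> makes the prefix before the slots at least half of the text,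
  as \<open>zero_half\<close> demands.\<close>

lemma sparse_text_marked_text:
  assumes "2 * m \<le> L"
  shows "sparse_text (marked_text L m S)"
proof
  fix i assume i: "i < length (marked_text L m S)" "marked_text L m S ! i \<noteq> 0"
  then obtain j where j: "j \<in> S" "j < m" "i = L + 2 * j" "marked_text L m S ! i = Suc j"
    by (auto elim: marked_text_nonzeroE)
  show "length (marked_text L m S) \<le> 2 * i" using j assms by simp
  show "Suc i < length (marked_text L m S) \<and> marked_text L m S ! Suc i = 0"
    using j by (simp add: nth_marked_text)
  fix i' assume "i' < i"
  show "marked_text L m S ! i' \<noteq> marked_text L m S ! i"
  proof
    assume eq: "marked_text L m S ! i' = marked_text L m S ! i"
    have "i' < L + 2 * m" "marked_text L m S ! i' \<noteq> 0"
      using i \<open>i' < i\<close> eq by auto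
    then obtain j' where "i' = L + 2 * j'" "marked_text L m S ! i' = Suc j'"
      by (auto elim: marked_text_nonzeroE)
    with j eq \<open>i' < i\<close> show False by simp
  qed
qed

lemma lz77_size_marked_text:
  assumes "2 * m \<le> L" "L \<ge> 3" "S \<subseteq> {..<m}"
  shows "lz77_size (marked_text L m S) = 2 + 2 * card S"
proof -
  have "{i. i < L + 2 * m \<and> marked_text L m S ! i \<noteq> 0} = (\<lambda>j. L + 2 * j) ` S"
    using assms(3) by (auto elim: marked_text_nonzeroE simp: nth_marked_text)
  then have "card {i. i < L + 2 * m \<and> marked_text L m S ! i \<noteq> 0} = card S"
    by (simp add: card_image inj_on_def)
  then show ?thesis
    using sparse_text.lz77_size_eq[OF sparse_text_marked_text[OF assms(1), of S]] assms(2) by simp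
qed

lemma marked_text_in_texts:
  assumes "m < \<sigma>"
  shows "marked_text L m S \<in> texts (L + 2 * m) \<sigma>"
  using assms by (auto simp: texts_def marked_text_def)

lemma inj_on_marked_text: "inj_on (marked_text L m) (Pow {..<m})"
proof (rule inj_on_inverseI)
  show "{j. j < m \<and> marked_text L m S ! (L + 2 * j) \<noteq> 0} = S" if "S \<in> Pow {..<m}" for S
    using that by (auto simp: nth_marked_text split: if_splits)
qed

section \<open>Query lower bound for distinguishing \<open>k\<close> from \<open>k + 1\<close>
  marks\<close>

lemma output_prob_mono: "T \<le> T' \<Longrightarrow> output_prob A X T v \<le> output_prob A X T' v"
  unfolding output_prob_def by (intro sum_mono2) (auto intro: sum_nonneg)

text \<open>The graph joins levels \<open>k\<close> and \<open>k + 1\<close> of the subset lattice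
  of \<open>m\<close> slots, an edge \<open>(S, j)\<close> inserting \<open>j\<close> into
  \<open>S\<close>; the degrees are \<open>m - k\<close> and \<open>k + 1\<close>. Both levels are
  run up to the larger of the two query bounds.\<close>

lemma lz77_size_query_bound:
  assumes A: "valid_algorithm A n \<sigma>" "computes_lz77_size A n \<sigma> Z q"
    and m: "4 * m \<le> n" "6 \<le> n" "m < \<sigma>" "k < m"
    and Z: "2 * k + 2 \<in> Z" "2 * k + 4 \<in> Z"
  shows "sqrt (real (m - k) * real (k + 1)) \<le> 36 * real (max (q (2 * k + 2)) (q (2 * k + 4)))"
proof -
  define L where "L = n - 2 * m"
  have L: "2 * m \<le> L" "L \<ge> 3" and n: "n = L + 2 * m" using m by (auto simp: L_def)
  define F where "F l = {S. S \<subseteq> {..<m} \<and> card S = l}" for l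
  have F: "finite (F l)" "card (F l) = m choose l" for l
    using n_subsets[of "{..<m}" l] by (auto simp: F_def)
  have fin: "finite S" if "S \<in> F l" for S l
    using that finite_subset[of S "{..<m}"] by (auto simp: F_def)
  define E where "E = (SIGMA S:F k. {..<m} - S)"
  have out: "output_prob A X T (2 * l + 2) \<ge> 2 / 3"
    if X: "X \<in> marked_text L m ` F l" and "2 * l + 2 \<in> Z" "q (2 * l + 2) \<le> T" for X l T
  proof -
    obtain S where S: "X = marked_text L m S" "S \<subseteq> {..<m}" "card S = l"
      using X unfolding F_def by blast
    then have "lz77_size X = 2 * l + 2" by (simp add: lz77_size_marked_text L)
    moreover have "X \<in> texts n \<sigma>" using marked_text_in_texts[OF m(3)] by (simp add: S n)
    ultimately have "output_prob A X (q (2 * l + 2)) (2 * l + 2) \<ge> 2 / 3"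
      using A(2) that(2) unfolding computes_lz77_size_def by metis
    with output_prob_mono[OF that(3), of A X "2 * l + 2"] show ?thesis by linarith
  qed
  have card_E: "card E = (m choose k) * (m - k)"
  proof -
    have "card E = (\<Sum>S\<in>F k. card ({..<m} - S))"
      unfolding E_def by (rule card_SigmaI) (auto simp: F)
    also have "\<dots> = (\<Sum>S\<in>F k. m - k)"
      using fin by (intro sum.cong refl) (auto simp: F_def card_Diff_subset)
    finally show ?thesis by (simp add: F)
  qed
  \<comment> \<open>The same edges counted from the upper level: a set of size \<open>Suc k\<close>
    arises by inserting any one of its elements.\<close>
  also have "\<dots> = Suc k * (m choose Suc k)"
    using binomial_absorption[of k m] binomial_absorb_comp[of m k] by (simp add: mult.commute)
  finally have card_E': "card E = Suc k * (m choose Suc k)" .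
  show ?thesis
  proof (rule adversary_bound[where
        \<X> = "marked_text L m ` F k" and \<Y> = "marked_text L m ` F (Suc k)" and E = E
        and src = "\<lambda>(S, j). marked_text L m S" and tgt = "\<lambda>(S, j). marked_text L m (insert j S)"
        and pos = "\<lambda>(S, j). L + 2 * j" and u = "2 * k + 2" and v = "2 * Suc k + 2", OF A(1)])
    show "finite E" by (auto simp: E_def F)
    have "card E > 0" using m(4) by (simp add: card_E)
    then show "E \<noteq> {}" by auto
    show "marked_text L m ` F k \<subseteq> texts n \<sigma>" "marked_text L m ` F (Suc k) \<subseteq> texts n \<sigma>"
      using marked_text_in_texts[OF m(3)] by (auto simp: n)
    show "(\<lambda>(S, j). marked_text L m S) ` E \<subseteq> marked_text L m ` F k"
      by (auto simp: E_def)
    show "(\<lambda>(S, j). marked_text L m (insert j S)) ` E \<subseteq> marked_text L m ` F (Suc k)"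
      using fin by (auto simp: E_def F_def intro!: imageI)
    show "(\<lambda>(S, j). L + 2 * j) ` E \<subseteq> {..<n}"
      by (auto simp: E_def n)
    show "inj_on (\<lambda>e. (case e of (S, j) \<Rightarrow> marked_text L m S, case e of (S, j) \<Rightarrow> L + 2 * j)) E"
      by (auto simp: inj_on_def E_def F_def dest: inj_onD[OF inj_on_marked_text])
    show "inj_on (\<lambda>e. (case e of (S, j) \<Rightarrow> marked_text L m (insert j S),
        case e of (S, j) \<Rightarrow> L + 2 * j)) E"
    proof (rule inj_onI, clarsimp)
      fix S S' j assume *: "(S, j) \<in> E" "(S', j) \<in> E"
        "marked_text L m (insert j S) = marked_text L m (insert j S')"
      then have "insert j S = insert j S'"
        by (intro inj_onD[OF inj_on_marked_text]) (auto simp: E_def F_def)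
      \<comment> \<open>\<open>j\<close> lies in neither \<open>S\<close> nor
        \<open>S'\<close>.\<close>
      with * show "S = S'" by (auto simp: E_def)
    qed
    \<comment> \<open>The character in slot \<open>j\<close> depends on \<open>j\<close> alone, so
      marking it changes only position \<open>L + 2 * j\<close>.\<close>
    show "(case e of (S, j) \<Rightarrow> marked_text L m S) ! i =
        (case e of (S, j) \<Rightarrow> marked_text L m (insert j S)) ! i"
      if "e \<in> E" "i < n" "i \<noteq> (case e of (S, j) \<Rightarrow> L + 2 * j)" for e i
      using that by (auto simp: nth_marked_text n split: prod.splits elim!: evenE)
    show "output_prob A X (max (q (2 * k + 2)) (q (2 * k + 4))) (2 * k + 2) \<ge> 2 / 3"
      if "X \<in> marked_text L m ` F k" for X
      using out[OF that] Z by simp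
    show "output_prob A X (max (q (2 * k + 2)) (q (2 * k + 4))) (2 * Suc k + 2) \<ge> 2 / 3"
      if "X \<in> marked_text L m ` F (Suc k)" for X
      using out[OF that] Z by (simp add: numeral_eq_Suc)
    show "real (m - k) * card (marked_text L m ` F k) \<le> card E"
    proof -
      have "card (marked_text L m ` F k) * (m - k) \<le> card E"
        unfolding card_E using card_image_le[OF F(1)] F(2) by (metis mult_le_mono1)
      then show ?thesis unfolding of_nat_mult[symmetric] of_nat_le_iff by (simp add: mult.commute)
    qed
    show "real (k + 1) * card (marked_text L m ` F (Suc k)) \<le> card E"
    proof -
      have "Suc k * card (marked_text L m ` F (Suc k)) \<le> card E"
        unfolding card_E' using card_image_le[OF F(1)] F(2) by (metis mult_le_mono2)
      then show ?thesis unfolding of_nat_mult[symmetric] of_nat_le_iff by simp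
    qed
  qed (use m in \<open>auto simp: F\<close>)
qed

section \<open>Choice of the parameters for large \<open>n\<close>\<close>

theorem theorem7p8:
  fixes \<xi> \<epsilon> c :: real and \<sigma> :: "nat \<Rightarrow> nat"
  assumes "0 < \<xi>" and "\<xi> < 1" and "\<epsilon> > 0"
    and "c \<ge> 1" and "(\<lambda>n. real (\<sigma> n)) \<in> \<Theta>(\<lambda>n. real n powr c)"
  shows "\<not> (\<exists>(A :: nat \<Rightarrow> query_algorithm) (q :: nat \<Rightarrow> nat \<Rightarrow> nat).
           (\<forall>n\<ge>1. valid_algorithm (A n) n (\<sigma> n) \<and>
                   computes_lz77_size (A n) n (\<sigma> n) (size_range \<xi> \<epsilon> n) (q n)) \<and>
           (\<forall>\<delta>>0. \<forall>\<^sub>F n in sequentially. \<forall>z\<in>size_range \<xi> \<epsilon> n.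
              real (q n z) \<le> \<delta> * sqrt (real z * real n)))"
proof safe
  fix A :: "nat \<Rightarrow> query_algorithm" and q :: "nat \<Rightarrow> nat \<Rightarrow> nat"
  assume A: "\<forall>n\<ge>1. valid_algorithm (A n) n (\<sigma> n) \<and>
      computes_lz77_size (A n) n (\<sigma> n) (size_range \<xi> \<epsilon> n) (q n)"
    and q: "\<forall>\<delta>>0. \<forall>\<^sub>F n in sequentially. \<forall>z\<in>size_range \<xi> \<epsilon> n.
      real (q n z) \<le> \<delta> * sqrt (real z * real n)"
  obtain \<kappa> where "\<kappa> > 0" and \<kappa>: "\<forall>\<^sub>F n in sequentially. norm (real (\<sigma> n)) \<ge> \<kappa> * norm (real n powr c)"
    using landau_omega.bigE[OF bigthetaD2[OF assms(5)]] by blast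
  \<comment> \<open>\<open>m\<close> will be about \<open>\<rho> * n\<close>: the bound 1/4 gives
    \<open>4 * m <= n\<close>, and \<open>\<kappa> / 2\<close> keeps \<open>m\<close> below the
    alphabet size.\<close>
  define \<rho> where "\<rho> = min (1 / 4) (\<kappa> / 2)"
  have \<rho>: "\<rho> > 0" "\<rho> \<le> 1 / 4" "\<rho> \<le> \<kappa> / 2" using \<open>\<kappa> > 0\<close> by (auto simp: \<rho>_def)
  \<comment> \<open>With 288 = 36 * 2 * 4 the assumed upper bound becomes half of the lower bound
    derived below.\<close>
  define \<delta> where "\<delta> = sqrt \<rho> / 288"
  have "\<delta> > 0" using \<rho> by (simp add: \<delta>_def)
  have "\<forall>\<^sub>F n in sequentially. real n powr \<xi> \<ge> 8"
    using assms(1) by real_asymp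
  \<comment> \<open>As \<open>\<epsilon>\<close> is positive, the range of \<open>z\<close>
    eventually contains all integers from \<open>t / 2\<close> to \<open>t\<close>.\<close>
  moreover have "\<forall>\<^sub>F n in sequentially. (real n powr \<xi>) powr (1 - \<epsilon>) \<le> real n powr \<xi> / 2"
  proof -
    have "\<forall>\<^sub>F n in sequentially. (real n powr \<xi>) powr \<epsilon> \<ge> 2"
      unfolding powr_powr using mult_pos_pos[OF assms(1,3)] by real_asymp
    then show ?thesis
      using eventually_gt_at_top[of 0] by eventually_elim (simp add: powr_diff field_simps)
  qed
  \<comment> \<open>Here \<open>\<xi> < 1\<close> enters: \<open>k\<close> is small against
    \<open>m\<close>, so that \<open>m - k\<close> stays linear in \<open>n\<close>.\<close>
  moreover have "\<forall>\<^sub>F n in sequentially. real n powr \<xi> / 4 + 1 \<le> \<rho> * real n / 4"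
    using assms(1,2) \<rho>(1) by real_asymp
  moreover have "\<forall>\<^sub>F n in sequentially. real n \<ge> 2 / \<rho>"
    by real_asymp
  moreover note \<kappa> eventually_ge_at_top[of 6] q[rule_format, OF \<open>\<delta> > 0\<close>]
  ultimately have "\<forall>\<^sub>F n in sequentially. False"
  proof eventually_elim
    case (elim n)
    define t where "t = real n powr \<xi>"
    define k where "k = nat \<lfloor>t / 4\<rfloor>"
    define m where "m = nat \<lfloor>\<rho> * n\<rfloor>"
    have t: "t \<ge> 8" "t powr (1 - \<epsilon>) \<le> t / 2" "t / 4 + 1 \<le> \<rho> * n / 4"
      using elim by (simp_all add: t_def)
    have k: "k \<le> t / 4" "t / 4 < k + 1" using t(1) unfolding k_def by linarith+
    have m: "m \<le> \<rho> * n" "\<rho> * n < m + 1" using mult_pos_pos[OF \<rho>(1), of "real n"] elim(6) unfolding m_def by linarith+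
    have "\<rho> * n \<ge> 2" using elim(4) \<rho>(1) by (simp add: field_simps)
    have "k < m" "real (m - k) \<ge> \<rho> * n / 4"
      using k m t \<open>\<rho> * n \<ge> 2\<close> by linarith+
    have "4 * m \<le> n"
    proof -
      have "\<rho> * n \<le> 1 / 4 * n" using \<rho>(2) by (intro mult_right_mono) auto
      with m(1) have "real (4 * m) \<le> n" by simp
      then show ?thesis by (simp only: of_nat_le_iff)
    qed
    have "m < \<sigma> n"
    proof -
      have "real n powr 1 \<le> real n powr c" using elim(6) assms(4) by (intro powr_mono) auto
      then have "\<kappa> * n \<le> \<kappa> * real n powr c" using elim(6) \<open>\<kappa> > 0\<close> by simp
      also have "\<dots> \<le> \<sigma> n" using elim(5) by simp
      finally have "\<kappa> * n \<le> \<sigma> n" .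
      moreover have "\<rho> * n \<le> \<kappa> / 2 * n" using \<rho>(3) by (intro mult_right_mono) auto
      moreover have "\<kappa> * n > 0" using \<open>\<kappa> > 0\<close> elim(6) by simp
      ultimately have "real m < \<sigma> n" using m(1) by (simp add: field_simps)
      then show ?thesis by simp
    qed
    \<comment> \<open>\<open>2 * k + 2 > t / 2\<close> by rounding, and
      \<open>2 * k + 4 <= t / 2 + 4 <= t\<close> because \<open>t >= 8\<close>.\<close>
    have Z: "2 * k + 2 \<in> size_range \<xi> \<epsilon> n" "2 * k + 4 \<in> size_range \<xi> \<epsilon> n"
      using k t by (auto simp: size_range_def Let_def simp flip: t_def)
    define s where "s = sqrt (real (k + 1) * n)"
    have "s > 0" using elim(6) by (simp add: s_def)
    have le: "real (q n z) \<le> \<delta> * (2 * s)"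
      if "z \<in> size_range \<xi> \<epsilon> n" "z \<le> 2 * k + 4" for z
    proof -
      \<comment> \<open>Comparing with \<open>4 * (k + 1)\<close> bounds both sizes by a multiple of
        \<open>k + 1\<close>, the degree in the lower bound; its root is the factor 2.\<close>
      have "real z \<le> real (4 * (k + 1))" using that(2) unfolding of_nat_le_iff by simp
      then have "sqrt (real z * n) \<le> sqrt (real (4 * (k + 1)) * n)"
        by (intro real_sqrt_le_mono mult_right_mono) auto
      also have "\<dots> = 2 * s"
        by (simp only: s_def of_nat_mult real_sqrt_mult mult.assoc) simp
      finally have "\<delta> * sqrt (real z * n) \<le> \<delta> * (2 * s)" using \<open>\<delta> > 0\<close> by simp
      with elim(7) that(1) show ?thesis by fastforce
    qed
    have "sqrt \<rho> / 2 * s = sqrt (\<rho> * n / 4 * real (k + 1))"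
      by (simp add: s_def real_sqrt_mult real_sqrt_divide mult_ac)
    also have "\<dots> \<le> sqrt (real (m - k) * real (k + 1))"
      using \<open>real (m - k) \<ge> \<rho> * n / 4\<close> by (intro real_sqrt_le_mono mult_right_mono) auto
    also have "\<dots> \<le> 36 * real (max (q n (2 * k + 2)) (q n (2 * k + 4)))"
      using A elim(6)
      by (intro lz77_size_query_bound[where A = "A n", OF _ _ \<open>4 * m \<le> n\<close> elim(6) \<open>m < \<sigma> n\<close> \<open>k < m\<close> Z]) auto
    also have "\<dots> \<le> 36 * (\<delta> * (2 * s))"
      using le[OF Z(1)] le[OF Z(2)] by (simp add: max_def)
    also have "\<dots> = sqrt \<rho> / 4 * s" by (simp add: \<delta>_def)
    finally show False using \<open>s > 0\<close> \<rho>(1) by simp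
  qed
  then show False by simp
qed

end
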